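(* Let $d\ge 1$ and let $\Delta$ be a pure $(d-1)$-dimensional simplicial complex on the vertex set $[n]=\{1,\dots,n\}$. Then the independence complex $\mathrm{Ind}(\Delta)$ is sortable if and only if $\Delta$ is a unit-interval simplicial complex.
   Context: Let $S=K[x_1,\dots,x_n]$ be a polynomial ring over a field $K$, and for $F\subseteq[n]$ put $\mathbf{x}_F=\prod_{i\in F}x_i$ ($\mathbf{x}_\emptyset=1$). Sorting: for monomials $u,v\in S$ write $uv=x_{i_1}x_{i_2}\cdots x_{i_r}$ with $i_1\le i_2\le\cdots\le i_r$, and set $\mathrm{sort}(u,v)=(u',v')$ with $u'=\prod_{j\text{ odd}}x_{i_j}$ and $v'=\prod_{j\text{ even}}x_{i_j}$. A finite set of monomials $\mathcal M$ is sortable if $\mathrm{sort}(u,v)\in\mathcal M\times\mathcal M$ for all $u,v\in\mathcal M$. A simplicial complex $\Gamma$ on $[n]$ is sortable if $\{\mathbf{x}_F: F\in\Gamma\}$ is sortable (with respect to the given labeling of the vertices). A simplicial complex is pure if all its facets (maximal faces) have the same dimension, where $\dim F=|F|-1$. Let $\Delta$ be pure of dimension $d-1$. A subset $C\subseteq[n]$ is a clique of $\Delta$ if all $d$-subsets of $C$ are facets of $\Delta$. A subset $D\subseteq[n]$ is independent if it contains no facet of $\Delta$; $\mathrm{Ind}(\Delta)$ is the simplicial complex of all independent sets. A simplicial complex $\Delta$ of dimension $d-1$ is a unit-interval simplicial complex if it is pure and for every facet $F=\{i_1<\cdots<i_d\}$ of $\Delta$ the interval $[i_1,i_d]=\{i_1,i_1+1,\dots,i_d\}$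 is a clique of $\Delta$. *)

theory Defs
  imports Complex_Main "HOL-Library.Poly_Mapping" "HOL-Library.Multiset"
begin

subsection \<open>Simplicial complexes\<close>

text \<open>A complex on \<open>[n]\<close> need not have every \<open>i \<in> [n]\<close> as a vertex: independence complexes
  are complexes on \<open>[n]\<close>, but they miss the vertex \<open>i\<close> whenever \<open>{i}\<close> is a facet of the original
  complex. The void family is excluded, so that the dimension is defined.\<close>

definition simplicial_complex :: "nat \<Rightarrow> nat set set \<Rightarrow> bool" where
  "simplicial_complex n \<Delta> \<longleftrightarrow>
     \<Delta> \<noteq> {} \<and> (\<forall>F\<in>\<Delta>. F \<subseteq> {1..n}) \<and> (\<forall>F\<in>\<Delta>. \<forall>G. G \<subseteq> F \<longrightarrow> G \<in> \<Delta>)"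

definition face_dim :: "nat set \<Rightarrow> int" where
  "face_dim F = int (card F) - 1"

definition complex_dim :: "nat set set \<Rightarrow> int" where
  "complex_dim \<Delta> = Max (face_dim ` \<Delta>)"

definition facets :: "nat set set \<Rightarrow> nat set set" where
  "facets \<Delta> = {F \<in> \<Delta>. \<forall>G\<in>\<Delta>. F \<subseteq> G \<longrightarrow> F = G}"

definition pure_complex :: "nat set set \<Rightarrow> bool" where
  "pure_complex \<Delta> \<longleftrightarrow> (\<forall>F\<in>facets \<Delta>. \<forall>G\<in>facets \<Delta>. face_dim F = face_dim G)"

text \<open>With \<open>d - 1 = complex_dim \<Delta>\<close>, the sets \<open>H\<close> below are the \<open>d\<close>-subsets of \<open>C\<close>.\<close>

definition is_clique :: "nat \<Rightarrow> nat set set \<Rightarrow> nat set \<Rightarrow> bool" where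
  "is_clique n \<Delta> C \<longleftrightarrow>
     C \<subseteq> {1..n} \<and> (\<forall>H. H \<subseteq> C \<and> int (card H) = complex_dim \<Delta> + 1 \<longrightarrow> H \<in> facets \<Delta>)"

definition is_independent :: "nat \<Rightarrow> nat set set \<Rightarrow> nat set \<Rightarrow> bool" where
  "is_independent n \<Delta> D \<longleftrightarrow> D \<subseteq> {1..n} \<and> \<not> (\<exists>F\<in>facets \<Delta>. F \<subseteq> D)"

definition Ind :: "nat \<Rightarrow> nat set set \<Rightarrow> nat set set" where
  "Ind n \<Delta> = {D. is_independent n \<Delta> D}"

text \<open>Only meaningful for \<open>complex_dim \<Delta> \<ge> 0\<close>, when all facets are nonempty.\<close>

definition unit_interval_complex :: "nat \<Rightarrow> nat set set \<Rightarrow> bool" where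
  "unit_interval_complex n \<Delta> \<longleftrightarrow>
     simplicial_complex n \<Delta> \<and> pure_complex \<Delta> \<and>
     (\<forall>F\<in>facets \<Delta>. is_clique n \<Delta> {Min F..Max F})"


subsection \<open>Sorting of monomials\<close>

text \<open>Polynomials over \<open>'k\<close> in variables indexed by \<open>nat\<close>: finitely supported maps from exponent
  vectors to coefficients, with the convolution product. The ring \<open>K[x\<^sub>1,\<dots>,x\<^sub>n]\<close> is the
  subring in which only the variables with index in \<open>{1..n}\<close> occur.\<close>

type_synonym 'k mpoly = "(nat \<Rightarrow>\<^sub>0 nat) \<Rightarrow>\<^sub>0 'k"

definition Var :: "nat \<Rightarrow> 'k::field mpoly" where
  "Var i = Poly_Mapping.single (Poly_Mapping.single i 1) 1"

definition word_monomial :: "nat list \<Rightarrow> 'k::field mpoly" where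
  "word_monomial is = (\<Prod>i\<leftarrow>is. Var i)"

definition monomials :: "'k::field mpoly set" where
  "monomials = range word_monomial"

definition face_monomial :: "nat set \<Rightarrow> 'k::field mpoly" where
  "face_monomial F = (\<Prod>i\<in>F. Var i)"

definition sorted_word :: "'k::field mpoly \<Rightarrow> nat list" where
  "sorted_word w = (THE is. sorted is \<and> w = word_monomial is)"

text \<open>Lists are indexed from 0, so the odd positions \<open>j = 1, 3, \<dots>\<close> of the sorted word are its
  even list indices.\<close>

definition sort_pair :: "'k::field mpoly \<Rightarrow> 'k mpoly \<Rightarrow> 'k mpoly \<times> 'k mpoly" where
  "sort_pair u v =
     (word_monomial (nths (sorted_word (u * v)) {j. even j}),
      word_monomial (nths (sorted_word (u * v)) {j. odd j}))"

definition sortable :: "'k::field mpoly set \<Rightarrow> bool" where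
  "sortable M \<longleftrightarrow> finite M \<and> M \<subseteq> monomials \<and> (\<forall>u\<in>M. \<forall>v\<in>M. sort_pair u v \<in> M \<times> M)"

definition sortable_complex :: "'k::field itself \<Rightarrow> nat set set \<Rightarrow> bool" where
  "sortable_complex _ \<Gamma> \<longleftrightarrow> sortable ((face_monomial :: nat set \<Rightarrow> 'k mpoly) ` \<Gamma>)"


subsection \<open>The sorted word of a monomial is well defined\<close>

lemma word_monomial_eq_single:
  "(word_monomial is :: 'k::field mpoly) =
     Poly_Mapping.single (\<Sum>i\<leftarrow>is. Poly_Mapping.single i 1) 1"
  by (induction "is") (simp_all add: word_monomial_def Var_def mult_single)

lemma lookup_sum_list_single:
  "Poly_Mapping.lookup (\<Sum>i\<leftarrow>is. Poly_Mapping.single i (1::nat)) k = count (mset is) k"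
  by (induction "is") (simp_all add: lookup_add lookup_single when_def)

lemma word_monomial_eq_iff:
  "(word_monomial is :: 'k::field mpoly) = word_monomial js \<longleftrightarrow> mset is = mset js"
proof
  assume "(word_monomial is :: 'k mpoly) = word_monomial js"
  then have "Poly_Mapping.keys (word_monomial is :: 'k mpoly) =
             Poly_Mapping.keys (word_monomial js :: 'k mpoly)"
    by simp
  then have "(\<Sum>i\<leftarrow>is. Poly_Mapping.single i (1::nat)) = (\<Sum>i\<leftarrow>js. Poly_Mapping.single i 1)"
    by (simp add: word_monomial_eq_single)
  then show "mset is = mset js"
    by (metis lookup_sum_list_single multiset_eq_iff)
next
  assume "mset is = mset js"
  then have "(\<Sum>i\<leftarrow>is. Poly_Mapping.single i (1::nat)) = (\<Sum>i\<leftarrow>js. Poly_Mapping.single i 1)"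
    by (intro poly_mapping_eqI) (simp only: lookup_sum_list_single)
  then show "(word_monomial is :: 'k mpoly) = word_monomial js"
    by (simp add: word_monomial_eq_single)
qed

lemma sorted_word_word_monomial:
  "sorted_word (word_monomial is :: 'k::field mpoly) = sort is"
  unfolding sorted_word_def
  by (rule the_equality) (auto simp: word_monomial_eq_iff intro: properties_for_sort[symmetric])

lemma word_monomial_mult:
  "(word_monomial is :: 'k::field mpoly) * word_monomial js = word_monomial (is @ js)"
  by (simp add: word_monomial_def)

end

theory Submission imports Defs begin

text \<open>Sorting is controlled by counting: if \<open>c t\<close> elements of \<open>A\<close> and \<open>B\<close>, counted with
  multiplicity, are at most \<open>t\<close>, then the two halves of the sorted word have \<open>\<lceil>c t / 2\<rceil>\<close> and
  \<open>\<lfloor>c t / 2\<rfloor>\<close> elements at most \<open>t\<close>. So if a half contains \<open>d\<close> elements of an interval, then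
  \<open>A\<close> or \<open>B\<close> already does; for a unit-interval complex this makes sortings of independent sets
  independent.

  Conversely, let \<open>F\<close> be a facet, \<open>x, y \<in> F\<close> and \<open>j \<notin> F\<close> strictly between \<open>x\<close> and \<open>y\<close>. The first
  half of the sorting of \<open>F - x + j\<close> and \<open>F - y\<close> is \<open>F\<close>, which is dependent, while \<open>F - y\<close> is too
  small to be dependent. Hence \<open>F - x + j\<close> is a facet, and such exchanges transform \<open>F\<close> into any
  set of the same size in the interval that \<open>F\<close> spans.\<close>

section \<open>Face monomials and the halves of a sorted word\<close>

lemma face_monomial_eq_word_monomial:
  assumes "finite A" and "mset xs = mset_set A"
  shows "face_monomial A = word_monomial xs"
proof -
  have "face_monomial A = prod_mset (image_mset Var (mset_set A))"
    by (simp add: face_monomial_def prod_unfold_prod_mset)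
  also have "\<dots> = word_monomial xs"
    by (simp add: word_monomial_def prod_mset_prod_list flip: assms(2) mset_map)
  finally show ?thesis .
qed

lemma word_monomial_eq_face_monomial_iff:
  assumes "finite A"
  shows "(word_monomial xs :: 'k::field mpoly) = face_monomial A \<longleftrightarrow> mset xs = mset_set A"
proof -
  have "mset (sorted_list_of_set A) = mset_set A"
    using assms by (metis mset_sorted_list_of_multiset sorted_list_of_mset_set)
  then show ?thesis
    by (simp add: word_monomial_eq_iff
        face_monomial_eq_word_monomial[OF assms, of "sorted_list_of_set A"])
qed

text \<open>\<open>antimono P\<close> makes \<open>P\<close> downward closed, so the letters
  satisfying it form a prefix of the sorted word. Putting a letter in front swaps the two index
  parities, which accounts for rounding up in one half and down in the other.\<close>

lemma length_filter_nths_parity: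
  fixes xs :: "'a::linorder list"
  assumes "sorted xs" and "antimono P"
  shows "length (filter P (nths xs {j. even j})) = (length (filter P xs) + 1) div 2
       \<and> length (filter P (nths xs {j. odd j})) = length (filter P xs) div 2"
  using assms(1)
proof (induction xs)
  case Nil
  then show ?case by simp
next
  case (Cons x xs)
  have *: "nths (x # xs) {j. even j} = x # nths xs {j. odd j}"
    "nths (x # xs) {j. odd j} = nths xs {j. even j}"
    by (simp_all add: nths_Cons)
  show ?case
  proof (cases "P x")
    case True
    then show ?thesis using Cons * by simp
  next
    case False
    \<comment> \<open>The head is the least letter, so \<open>P\<close> fails throughout and all
      counts vanish, as \<open>(0 + 1) div 2 = 0\<close>.\<close>
    then have "\<not> P y" if "y \<in> set (x # xs)" for y
      using Cons.prems that antimonoD[OF assms(2), of x y] by auto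
    then have "filter P (x # xs) = []" "filter P (nths (x # xs) I) = []" for I
      unfolding filter_empty_conv using set_nths_subset[of "x # xs" I] by blast+
    then show ?thesis by simp
  qed
qed

text \<open>Later arguments see the sorting only through these counts and the inclusion of supports.
  General downward closed \<open>P\<close> cover both \<open>x \<le> b\<close> and
  \<open>x < a\<close>, whose counts differ by that of an interval.\<close>

lemma sort_pair_face_monomial:
  assumes "finite A" and "finite B"
  obtains us vs where
    "sort_pair (face_monomial A :: 'k::field mpoly) (face_monomial B)
       = (word_monomial us, word_monomial vs)"
    and "\<And>P. antimono P \<Longrightarrow>
      size (filter_mset P (mset us)) = (card {x\<in>A. P x} + card {x\<in>B. P x} + 1) div 2"
    and "\<And>P. antimono P \<Longrightarrow>
      size (filter_mset P (mset vs)) = (card {x\<in>A. P x} + card {x\<in>B. P x}) div 2"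
    and "set us \<union> set vs \<subseteq> A \<union> B"
proof -
  define as where "as = sorted_list_of_set A"
  define bs where "bs = sorted_list_of_set B"
  have as: "mset as = mset_set A" and bs: "mset bs = mset_set B"
    unfolding as_def bs_def by (metis mset_sorted_list_of_multiset sorted_list_of_mset_set)+
  define w where "w = sort (as @ bs)"
  have w: "sorted_word ((face_monomial A :: 'k mpoly) * face_monomial B) = w"
    by (simp add: face_monomial_eq_word_monomial[OF assms(1) as]
        face_monomial_eq_word_monomial[OF assms(2) bs] word_monomial_mult
        sorted_word_word_monomial w_def)
  have mset_w: "mset w = mset_set A + mset_set B"
    by (simp add: w_def as bs)
  have "length (filter P w) = card {x\<in>A. P x} + card {x\<in>B. P x}" for P
  proof -
    have "length (filter P w) = size (filter_mset P (mset w))"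
      by (simp flip: size_mset)
    then show ?thesis using assms by (simp add: mset_w)
  qed
  moreover have "set (nths w I) \<subseteq> A \<union> B" for I
  proof -
    have "set w = A \<union> B"
      using mset_w assms by (metis finite_set_mset_mset_set set_mset_mset set_mset_union)
    then show ?thesis using set_nths_subset by fast
  qed
  moreover have "sorted w" by (simp add: w_def)
  ultimately show ?thesis
    using length_filter_nths_parity[of w]
    by (intro that[of "nths w {j. even j}" "nths w {j. odd j}"])
      (simp_all add: sort_pair_def w flip: mset_filter)
qed

section \<open>Counting a half over an interval\<close>

lemma size_filter_mset_interval:
  fixes U :: "nat multiset"
  assumes "a \<le> b"
  shows "size {#x \<in># U. x \<le> b#} = size {#x \<in># U. x < a#} + size {#x \<in># U. a \<le> x \<and> x \<le> b#}"
proof -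
  have "{#x \<in># U. x \<le> b#} = {#x \<in># U. x < a#} + {#x \<in># U. a \<le> x \<and> x \<le> b#}"
    using assms by (intro multiset_eqI) auto
  then show ?thesis by simp
qed

lemma card_interval:
  fixes A :: "nat set"
  assumes "finite A" and "a \<le> b"
  shows "card {x\<in>A. x \<le> b} = card {x\<in>A. x < a} + card {x\<in>A. a \<le> x \<and> x \<le> b}"
  using size_filter_mset_interval[OF assms(2), of "mset_set A"] assms(1) by simp

text \<open>The parameter \<open>e\<close> treats both halves at once: \<open>1\<close> rounds up,
  \<open>0\<close> rounds down. An interval count is the difference of two prefix counts rounded in
  the same direction, so it exceeds half of the total by at most 1/2.\<close>

lemma size_filter_mset_interval_halved:
  fixes A B :: "nat set"
  assumes "finite A" and "finite B" and "a \<le> b" and "e \<le> 1"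
    and half: "\<And>P. antimono P \<Longrightarrow>
      size (filter_mset P U) = (card {x\<in>A. P x} + card {x\<in>B. P x} + e) div 2"
  shows "2 * size {#x \<in># U. a \<le> x \<and> x \<le> b#}
    \<le> card {x\<in>A. a \<le> x \<and> x \<le> b} + card {x\<in>B. a \<le> x \<and> x \<le> b} + 1"
proof -
  have sizes: "size {#x \<in># U. x \<le> b#} = (card {x\<in>A. x \<le> b} + card {x\<in>B. x \<le> b} + e) div 2"
    "size {#x \<in># U. x < a#} = (card {x\<in>A. x < a} + card {x\<in>B. x < a} + e) div 2"
    by (rule half, rule antimonoI, fastforce)+
  have arith: "2 * s \<le> q + r + 1"
    if "m + s = (p + q + (p' + r) + e) div 2" "m = (p + p' + e) div 2" for m p q p' r s :: nat
    using that by linarith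
  show ?thesis
    by (rule arith[OF _ sizes(2)])
      (use sizes(1) size_filter_mset_interval[OF \<open>a \<le> b\<close>, of U] card_interval[OF \<open>finite A\<close> \<open>a \<le> b\<close>]
        card_interval[OF \<open>finite B\<close> \<open>a \<le> b\<close>] in simp)
qed

text \<open>To the one-point interval at \<open>t\<close>, \<open>A\<close> and \<open>B\<close>
  contribute at most one each, so twice the multiplicity of \<open>t\<close> is at most 3. Hence a
  half is squarefree.\<close>

lemma halved_eq_mset_set:
  fixes A B :: "nat set"
  assumes "finite A" and "finite B" and "e \<le> 1"
    and "\<And>P. antimono P \<Longrightarrow>
      size (filter_mset P U) = (card {x\<in>A. P x} + card {x\<in>B. P x} + e) div 2"
  shows "U = mset_set (set_mset U)"
proof (rule multiset_eqI)
  fix t :: nat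
  have "card {x\<in>C. t \<le> x \<and> x \<le> t} \<le> 1" for C
    by (rule order.trans[OF card_mono[of "{t}"]]) auto
  from this[of A] this[of B]
  have "size {#x \<in># U. t \<le> x \<and> x \<le> t#} \<le> 1"
    using size_filter_mset_interval_halved[OF assms(1,2) order.refl[of t] assms(3,4)] by linarith
  moreover have "{#x \<in># U. t \<le> x \<and> x \<le> t#} = {#x \<in># U. x = t#}"
    by (intro filter_mset_cong) auto
  ultimately have "count U t \<le> 1"
    by (simp add: filter_eq_replicate_mset)
  then show "count U t = count (mset_set (set_mset U)) t"
    by (cases "t \<in># U") (auto simp: count_eq_zero_iff le_Suc_eq)
qed

section \<open>Counting functions and exchanges\<close>

lemma set_eq_if_card_atMost_eq:
  fixes F G :: "nat set"
  assumes "finite F" and "finite G" and "\<And>t. card {x\<in>F. x \<le> t} = card {x\<in>G. x \<le> t}"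
  shows "F = G"
proof -
  \<comment> \<open>A set is recovered from its counting function by the points at which the
    function jumps.\<close>
  have step: "card {x\<in>C. x \<le> t} = card {x\<in>C. x < t} + (if t \<in> C then 1 else 0)"
    if "finite C" for C :: "nat set" and t
  proof -
    have "{x\<in>C. t \<le> x \<and> x \<le> t} = (if t \<in> C then {t} else {})" by auto
    then show ?thesis using card_interval[OF that order.refl[of t]] by simp
  qed
  have below: "card {x\<in>F. x < t} = card {x\<in>G. x < t}" for t
  proof (cases t)
    case (Suc s)
    then show ?thesis using assms(3)[of s] by (simp add: less_Suc_eq_le)
  qed simp
  have "t \<in> F \<longleftrightarrow> t \<in> G" for t
    using step[OF assms(1), of t] step[OF assms(2), of t] below[of t] assms(3)[of t]
    by (auto split: if_splits)
  then show ?thesis by blast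
qed

text \<open>With \<open>c\<close> elements of \<open>F\<close> up to \<open>t\<close>, the dividend
  is \<open>2 * c + 1\<close>, less one for each of \<open>x\<close> and \<open>y\<close> up to
  \<open>t\<close>, plus one if \<open>j \<le> t\<close>. As \<open>j\<close> lies strictly between
  \<open>x\<close> and \<open>y\<close>, this is \<open>2 * c\<close> or
  \<open>2 * c + 1\<close>.\<close>

lemma card_exchange_atMost:
  fixes F :: "nat set"
  assumes "finite F" and "x \<in> F" and "y \<in> F" and "j \<notin> F"
    and "x < j \<and> j < y \<or> y < j \<and> j < x"
  shows "(card {z\<in>insert j (F - {x}). z \<le> t} + card {z\<in>F - {y}. z \<le> t} + 1) div 2
    = card {z\<in>F. z \<le> t}"
proof -
  have rem: "card {z\<in>F. z \<le> t} = card {z\<in>F - {u}. z \<le> t} + (if u \<le> t then 1 else 0)"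
    if "u \<in> F" for u
  proof -
    have "{z\<in>F. z \<le> t} = (if u \<le> t then insert u {z\<in>F - {u}. z \<le> t} else {z\<in>F - {u}. z \<le> t})"
      using that by auto
    then show ?thesis using \<open>finite F\<close> by simp
  qed
  have "{z\<in>insert j (F - {x}). z \<le> t}
      = (if j \<le> t then insert j {z\<in>F - {x}. z \<le> t} else {z\<in>F - {x}. z \<le> t})"
    by auto
  then have "card {z\<in>insert j (F - {x}). z \<le> t}
      = card {z\<in>F - {x}. z \<le> t} + (if j \<le> t then 1 else 0)"
    using \<open>finite F\<close> \<open>j \<notin> F\<close> by simp
  then show ?thesis
    using rem[OF \<open>x \<in> F\<close>] rem[OF \<open>y \<in> F\<close>] assms(5) by (auto split: if_splits)
qed

text \<open>\<open>\<F>\<close> will be membership in \<open>facets \<Delta>\<close>. Induction on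
  the number of elements of \<open>H\<close> missing from \<open>F\<close>: an exchange inserts one
  of them and removes an element outside \<open>H\<close>, so the point is to keep \<open>H\<close>
  spanned by the new set.\<close>

lemma exchange_spanned_subset:
  fixes F H :: "nat set"
  assumes "finite F" and "\<F> F" and "card H = card F" and "finite H"
    and "\<And>h. h \<in> H \<Longrightarrow> \<exists>a\<in>F. \<exists>b\<in>F. a \<le> h \<and> h \<le> b"
    and exch: "\<And>F x y j. \<lbrakk>\<F> F; x \<in> F; y \<in> F; j \<notin> F; x < j \<and> j < y \<or> y < j \<and> j < x\<rbrakk>
      \<Longrightarrow> \<F> (insert j (F - {x}))"
  shows "\<F> H"
  using assms(1-5)
proof (induction "card (H - F)" arbitrary: F rule: less_induct)
  case less
  show ?case
  proof (cases "H = F")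
    case True
    then show ?thesis using less.prems by simp
  next
    case False
    have cards: "card (F - H) = card (H - F)"
      using less.prems by (simp add: card_Diff_subset_Int Int_commute)
    have ne: "F - H \<noteq> {}" "H - F \<noteq> {}"
      using False cards less.prems by (metis Diff_eq_empty_iff card_subset_eq)+
    text \<open>The lower bounds for \<open>H\<close> survive because the new element is the least one of \<open>H - F\<close>; the
      upper bounds because the greatest element of \<open>F\<close> is removed only in the last step.\<close>
    define x where "x = Min (F - H)"
    define j where "j = Min (H - F)"
    define F' where "F' = insert j (F - {x})"
    have x: "x \<in> F" "x \<notin> H" and x_le: "\<And>z. z \<in> F - H \<Longrightarrow> x \<le> z"
      using Min_in[of "F - H"] ne less.prems by (auto simp: x_def)
    have j: "j \<in> H" "j \<notin> F" and j_le: "\<And>z. z \<in> H - F \<Longrightarrow> j \<le> z"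
      using Min_in[of "H - F"] ne less.prems by (auto simp: j_def)
    obtain a b where ab: "a \<in> F" "b \<in> F" "a \<le> j" "j \<le> b"
      using less.prems(5)[OF j(1)] by blast
    have "a < j" "j < b" using ab j by (metis order_le_less)+
    moreover have "x \<noteq> j" using x j by blast
    \<comment> \<open>The exchange needs a \<open>y\<close> on the other side of \<open>j\<close>
      from \<open>x\<close>: take \<open>b\<close> if \<open>x < j\<close> and \<open>a\<close> if
      \<open>j < x\<close>.\<close>
    ultimately have "\<exists>y\<in>F. x < j \<and> j < y \<or> y < j \<and> j < x"
      using ab by (meson linorder_neqE_nat)
    then have "\<F> F'" unfolding F'_def using exch less.prems(2) x(1) j(2) by blast
    moreover have fin: "finite F'" using less.prems by (simp add: F'_def)
    moreover have card_eq: "card H = card F'"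
      using less.prems(1,3) x j card_Suc_Diff1[of F x] by (simp add: F'_def)
    moreover have "card (H - F') < card (H - F)"
      using less.prems(4) x j by (intro psubset_card_mono) (auto simp: F'_def)
    moreover have "\<exists>a\<in>F'. \<exists>b\<in>F'. a \<le> h \<and> h \<le> b" if h: "h \<in> H" for h
    proof (cases "Max F = x")
      case True
      \<comment> \<open>Here \<open>x\<close> is the least element of \<open>F - H\<close> and the
        greatest of \<open>F\<close>, so \<open>F - H\<close> has no other element and the exchange
        yields \<open>H\<close> itself.\<close>
      have "F - H = {x}"
        using True x_le Max_ge[OF less.prems(1)] x by (auto intro: antisym)
      then have "F' \<subseteq> H" using j by (auto simp: F'_def)
      then have "F' = H" using card_eq less.prems(4) by (metis card_subset_eq)
      then show ?thesis using h by blast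
    next
      case False
      then have "Max F \<in> F'"
        using Max_in[OF less.prems(1)] x by (auto simp: F'_def)
      moreover have "h \<le> Max F"
        using less.prems(5)[OF h] Max_ge[OF less.prems(1)] by (meson order.trans)
      moreover have "\<exists>a\<in>F'. a \<le> h"
        using h x j_le[of h] by (cases "h \<in> F") (auto simp: F'_def)
      ultimately show ?thesis by blast
    qed
    ultimately show ?thesis using less.hyps[of F'] less.prems(4) by blast
  qed
qed

section \<open>Facet sizes and finiteness of the independence complex\<close>

lemma simplicial_complex_finite:
  assumes "simplicial_complex n \<Delta>"
  shows "finite \<Delta>" and "F \<in> \<Delta> \<Longrightarrow> finite F"
proof -
  have "\<Delta> \<subseteq> Pow {1..n}" using assms by (auto simp: simplicial_complex_def)
  then show "finite \<Delta>" and "F \<in> \<Delta> \<Longrightarrow> finite F"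
    by (auto intro: finite_subset)
qed

text \<open>A face attaining \<open>complex_dim \<Delta>\<close> cannot be enlarged, so it is a
  facet; purity passes its size on to every facet.\<close>

lemma card_facet:
  assumes "simplicial_complex n \<Delta>" and "pure_complex \<Delta>" and "complex_dim \<Delta> = int d - 1"
    and "F \<in> facets \<Delta>"
  shows "card F = d"
proof -
  note fin = simplicial_complex_finite[OF assms(1)]
  have "\<Delta> \<noteq> {}" using assms(1) by (simp add: simplicial_complex_def)
  then have "complex_dim \<Delta> \<in> face_dim ` \<Delta>"
    using fin(1) unfolding complex_dim_def by (intro Max_in) auto
  then obtain G where G: "G \<in> \<Delta>" "face_dim G = complex_dim \<Delta>" by auto
  have "G \<in> facets \<Delta>"
    unfolding facets_def
  proof (intro CollectI conjI ballI impI)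
    fix H assume H: "H \<in> \<Delta>" "G \<subseteq> H"
    have "face_dim H \<le> complex_dim \<Delta>"
      using H fin(1) unfolding complex_dim_def by (intro Max_ge) auto
    then have "card H \<le> card G" using G by (simp add: face_dim_def)
    then show "G = H" using H fin(2) card_seteq by metis
  qed (use G in simp)
  then have "face_dim F = int d - 1"
    using assms(2-4) G(2) unfolding pure_complex_def by metis
  then show ?thesis by (simp add: face_dim_def)
qed

lemma finite_Ind: "finite (Ind n \<Delta>)"
proof -
  have "Ind n \<Delta> \<subseteq> Pow {1..n}" by (auto simp: Ind_def is_independent_def)
  then show ?thesis by (rule finite_subset) simp
qed

lemma finite_Ind_member: "A \<in> Ind n \<Delta> \<Longrightarrow> finite A"
  by (auto simp: Ind_def is_independent_def intro: finite_subset)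

section \<open>From unit-interval complexes to sortability\<close>

lemma sortable_Ind_if_unit_interval:
  assumes "d \<ge> 1" and "unit_interval_complex n \<Delta>" and "complex_dim \<Delta> = int d - 1"
  shows "sortable_complex TYPE('k::field) (Ind n \<Delta>)"
proof -
  have sc: "simplicial_complex n \<Delta>" and pure: "pure_complex \<Delta>"
    and clique: "\<And>F. F \<in> facets \<Delta> \<Longrightarrow> is_clique n \<Delta> {Min F..Max F}"
    using assms(2) by (auto simp: unit_interval_complex_def)
  have half_independent: "(word_monomial us :: 'k mpoly) \<in> face_monomial ` Ind n \<Delta>"
    if A: "A \<in> Ind n \<Delta>" and B: "B \<in> Ind n \<Delta>" and e: "e \<le> 1" and sub: "set us \<subseteq> A \<union> B"
      and half: "\<And>P. antimono P \<Longrightarrow>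
        size (filter_mset P (mset us)) = (card {x\<in>A. P x} + card {x\<in>B. P x} + e) div 2"
    for A B us e
  proof -
    note fin = finite_Ind_member[OF A] finite_Ind_member[OF B]
    \<comment> \<open>The half is squarefree, hence the face monomial of its support
      \<open>set us\<close>; it remains to see that the support is independent.\<close>
    have us: "mset us = mset_set (set us)"
      using halved_eq_mset_set[OF fin e half] by simp
    \<comment> \<open>The interval is a clique, so \<open>d\<close> elements of \<open>C\<close> in
      it would form a facet inside the independent set \<open>C\<close>.\<close>
    have few: "card {x\<in>C. Min F \<le> x \<and> x \<le> Max F} < d"
      if C: "C \<in> Ind n \<Delta>" and F: "F \<in> facets \<Delta>" for C F
    proof (rule ccontr)
      assume "\<not> ?thesis"
      then obtain H where H: "H \<subseteq> {x\<in>C. Min F \<le> x \<and> x \<le> Max F}" "card H = d"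
        by (meson not_less obtain_subset_with_card_n)
      moreover have "H \<subseteq> {Min F..Max F}" using H(1) by auto
      ultimately have "H \<in> facets \<Delta>"
        using clique[OF F] assms(3) unfolding is_clique_def by simp
      then show False using C H by (auto simp: Ind_def is_independent_def)
    qed
    have "\<not> F \<subseteq> set us" if F: "F \<in> facets \<Delta>" for F
    proof
      assume sub: "F \<subseteq> set us"
      have card: "card F = d" by (rule card_facet[OF sc pure assms(3) F])
      then have ne: "F \<noteq> {}" and finF: "finite F"
        using assms(1) by (auto intro: card_ge_0_finite)
      have "Min F \<le> Max F" using ne finF by simp
      \<comment> \<open>Both counts are at most \<open>d - 1\<close>, so the bound is
        \<open>2 * (d - 1) + 1\<close>, one short of the \<open>2 * d\<close> that \<open>F\<close>
        requires.\<close>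
      from size_filter_mset_interval_halved[OF fin this e half]
      have "2 * size {#x \<in># mset us. Min F \<le> x \<and> x \<le> Max F#} \<le> 2 * d - 1"
        using few[OF A F] few[OF B F] by linarith
      moreover have "size {#x \<in># mset us. Min F \<le> x \<and> x \<le> Max F#}
          = card {x\<in>set us. Min F \<le> x \<and> x \<le> Max F}"
        by (subst us) simp
      moreover have "d \<le> card {x\<in>set us. Min F \<le> x \<and> x \<le> Max F}"
        unfolding card[symmetric] using sub finF by (intro card_mono) auto
      ultimately show False using assms(1) by linarith
    qed
    moreover have "set us \<subseteq> {1..n}"
      using sub A B by (auto simp: Ind_def is_independent_def)
    ultimately have "set us \<in> Ind n \<Delta>"
      by (auto simp: Ind_def is_independent_def)
    moreover have "(word_monomial us :: 'k mpoly) = face_monomial (set us)"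
      using us by (simp add: word_monomial_eq_face_monomial_iff)
    ultimately show ?thesis by blast
  qed
  have "sort_pair (face_monomial A) (face_monomial B)
      \<in> (face_monomial ` Ind n \<Delta> \<times> face_monomial ` Ind n \<Delta> :: ('k mpoly \<times> _) set)"
    if AB: "A \<in> Ind n \<Delta>" "B \<in> Ind n \<Delta>" for A B
  proof -
    obtain us vs where
      *: "sort_pair (face_monomial A :: 'k mpoly) (face_monomial B)
        = (word_monomial us, word_monomial vs)"
      and us: "\<And>P. antimono P \<Longrightarrow>
        size (filter_mset P (mset us)) = (card {x\<in>A. P x} + card {x\<in>B. P x} + 1) div 2"
      and vs: "\<And>P. antimono P \<Longrightarrow>
        size (filter_mset P (mset vs)) = (card {x\<in>A. P x} + card {x\<in>B. P x}) div 2"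
      and sub: "set us \<union> set vs \<subseteq> A \<union> B"
      using sort_pair_face_monomial[OF finite_Ind_member[OF AB(1)] finite_Ind_member[OF AB(2)]]
      by blast
    have "(word_monomial us :: 'k mpoly) \<in> face_monomial ` Ind n \<Delta>"
      by (rule half_independent[OF AB, where e = 1]) (use us sub in auto)
    moreover have "(word_monomial vs :: 'k mpoly) \<in> face_monomial ` Ind n \<Delta>"
      by (rule half_independent[OF AB, where e = 0]) (use vs sub in auto)
    ultimately show ?thesis using * by simp
  qed
  moreover have "(face_monomial A :: 'k mpoly) \<in> monomials" if "A \<in> Ind n \<Delta>" for A
    using face_monomial_eq_word_monomial[OF finite_Ind_member[OF that], of "sorted_list_of_set A"]
    unfolding monomials_def
    by (metis mset_sorted_list_of_multiset rangeI sorted_list_of_mset_set)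
  ultimately show ?thesis
    unfolding sortable_complex_def sortable_def using finite_Ind by blast
qed

section \<open>From sortability to unit-interval complexes\<close>

lemma sortable_Ind_exchange:
  assumes "simplicial_complex n \<Delta>" and "pure_complex \<Delta>" and "complex_dim \<Delta> = int d - 1"
    and sortable: "sortable_complex TYPE('k::field) (Ind n \<Delta>)"
    and F: "F \<in> facets \<Delta>" "x \<in> F" "y \<in> F" "j \<notin> F"
    and between: "x < j \<and> j < y \<or> y < j \<and> j < x"
  shows "insert j (F - {x}) \<in> facets \<Delta>"
proof (rule ccontr)
  let ?A = "insert j (F - {x})" and ?B = "F - {y}"
  assume nonfacet: "?A \<notin> facets \<Delta>"
  have "F \<in> \<Delta>" using F(1) by (simp add: facets_def)
  then have F_sub: "F \<subseteq> {1..n}" and finF: "finite F"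
    using assms(1) simplicial_complex_finite by (auto simp: simplicial_complex_def)
  note card = card_facet[OF assms(1-3)]
  \<comment> \<open>All facets have \<open>d\<close> elements, so a facet inside \<open>?A\<close>
    would be \<open>?A\<close> itself, which is assumed not to be one.\<close>
  have "card ?A = d"
    using card[OF F(1)] finF F card_Suc_Diff1[of F x] by simp
  then have "\<not> G \<subseteq> ?A" if "G \<in> facets \<Delta>" for G
    using card[OF that] nonfacet that finF by (metis card_subset_eq finite_Diff finite_insert)
  moreover have "?A \<subseteq> {1..n}"
    using F_sub F(2,3) between by force
  ultimately have A: "?A \<in> Ind n \<Delta>"
    by (auto simp: Ind_def is_independent_def)
  have "card ?B < d"
    using card[OF F(1)] finF F(3) by (metis card_Diff1_less)
  then have "\<not> G \<subseteq> ?B" if "G \<in> facets \<Delta>" for G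
    using card[OF that] finF by (metis card_mono finite_Diff not_less)
  then have B: "?B \<in> Ind n \<Delta>"
    using F_sub by (auto simp: Ind_def is_independent_def)
  obtain us vs where
    us: "sort_pair (face_monomial ?A :: 'k mpoly) (face_monomial ?B)
      = (word_monomial us, word_monomial vs)"
    and half: "\<And>P. antimono P \<Longrightarrow>
      size (filter_mset P (mset us)) = (card {x\<in>?A. P x} + card {x\<in>?B. P x} + 1) div 2"
    by (rule sort_pair_face_monomial[OF finite_Ind_member[OF A] finite_Ind_member[OF B]])
      (rule that)
  have "sort_pair (face_monomial ?A :: 'k mpoly) (face_monomial ?B)
      \<in> face_monomial ` Ind n \<Delta> \<times> face_monomial ` Ind n \<Delta>"
    using sortable A B unfolding sortable_complex_def sortable_def by blast
  then obtain G where G: "G \<in> Ind n \<Delta>" "(word_monomial us :: 'k mpoly) = face_monomial G"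
    using us by auto
  have finG: "finite G" using G(1) by (rule finite_Ind_member)
  \<comment> \<open>The first half counts like \<open>F\<close> at every threshold, so
    \<open>G\<close> must be \<open>F\<close>; but \<open>G\<close> is independent and
    \<open>F\<close> is a facet.\<close>
  have "card {z\<in>F. z \<le> t} = card {z\<in>G. z \<le> t}" for t
  proof -
    have at_most: "antimono (\<lambda>z. z \<le> t)" by (rule antimonoI) fastforce
    have "size {#z \<in># mset us. z \<le> t#} = card {z\<in>F. z \<le> t}"
      using half[of "\<lambda>z. z \<le> t"] at_most card_exchange_atMost[OF finF F(2-4) between, of t] by simp
    moreover have "mset us = mset_set G"
      using G(2) word_monomial_eq_face_monomial_iff[OF finG] by blast
    ultimately show ?thesis using finG by simp
  qed
  then have "F = G" by (rule set_eq_if_card_atMost_eq[OF finF finG])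
  then show False using G(1) F(1) by (auto simp: Ind_def is_independent_def)
qed

lemma unit_interval_if_sortable_Ind:
  assumes "d \<ge> 1" and "simplicial_complex n \<Delta>" and "pure_complex \<Delta>"
    and "complex_dim \<Delta> = int d - 1"
    and "sortable_complex TYPE('k::field) (Ind n \<Delta>)"
  shows "unit_interval_complex n \<Delta>"
  unfolding unit_interval_complex_def
proof (intro conjI ballI assms(2,3))
  fix F assume F: "F \<in> facets \<Delta>"
  note card = card_facet[OF assms(2-4) F]
  \<comment> \<open>\<open>d \<ge> 1\<close> makes the facet nonempty, so \<open>Min F\<close> and
    \<open>Max F\<close> are genuine elements of it.\<close>
  then have ne: "F \<noteq> {}" and fin: "finite F"
    using assms(1) by (auto intro: card_ge_0_finite)
  have "F \<subseteq> {1..n}"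
    using F assms(2) by (auto simp: facets_def simplicial_complex_def)
  moreover have in_F: "Min F \<in> F" "Max F \<in> F" using ne fin by auto
  ultimately have "{Min F..Max F} \<subseteq> {1..n}"
    by (meson atLeastatMost_subset_iff atLeastAtMost_iff subsetD)
  moreover have "H \<in> facets \<Delta>"
    if "H \<subseteq> {Min F..Max F}" "int (card H) = complex_dim \<Delta> + 1" for H
  \<comment> \<open>\<open>Min F\<close> and \<open>Max F\<close> serve as bounds for every element
    of \<open>H\<close>, so exchanges within the facets lead from \<open>F\<close> to
    \<open>H\<close>.\<close>
  proof (rule exchange_spanned_subset[where \<F> = "\<lambda>F. F \<in> facets \<Delta>", OF fin F])
    show "card H = card F" using that assms(4) card by simp
    show "finite H" using that finite_subset by blast
    show "\<exists>a\<in>F. \<exists>b\<in>F. a \<le> h \<and> h \<le> b" if "h \<in> H" for h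
      using that \<open>H \<subseteq> _\<close> in_F by (meson atLeastAtMost_iff subsetD)
  qed (rule sortable_Ind_exchange[OF assms(2-5)])
  ultimately show "is_clique n \<Delta> {Min F..Max F}"
    unfolding is_clique_def by blast
qed

theorem theorem1p1:
  fixes n d :: nat and \<Delta> :: "nat set set"
  assumes "d \<ge> 1"
    and "simplicial_complex n \<Delta>"
    and "pure_complex \<Delta>"
    and "complex_dim \<Delta> = int d - 1"
  shows "sortable_complex TYPE('k::field) (Ind n \<Delta>) \<longleftrightarrow> unit_interval_complex n \<Delta>"
  using sortable_Ind_if_unit_interval[OF assms(1) _ assms(4)]
    unit_interval_if_sortable_Ind[OF assms]
  by blast

end
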